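(* Let $M<-1$ be a real number and let $r$ be an odd positive integer. Let $a_r,a_{r-1},\ldots,a_1$ be positive integers chosen successively as follows: $a_r\ge 2$, and put $s_r=1-\frac{M+1}{a_r}$; then for $i=r-1,r-2,\ldots,1$: if $i$ is even, choose $a_i>-M\left(1-\frac{1}{s_{i+1}}\right)$ and put $s_i=g\!\left(s_{i+1},-\frac{M}{a_i}\right)$; if $i$ is odd, choose $a_i>-\frac{M+1}{1-s_{i+1}}$ and put $s_i=f\!\left(s_{i+1},1-\frac{M+1}{a_i}\right)$. Then the threshold graph $T_G(a_1,a_2,\ldots,a_r)$ is $[M,-1)$-eigenvalue free.
   Context: All graphs are finite, simple and undirected; eigenvalues are those of the adjacency matrix. A graph is $I$-eigenvalue free, for an interval $I\subseteq\mathbb{R}$, if it has no eigenvalue in $I$. For an integer $r\ge 1$ and positive integers $a_1,\ldots,a_r$ with $a_r\ge 2$, the threshold graph $T_G(a_1,\ldots,a_r)$ is defined as follows: start with $G_r=K_{a_r}$ if $r$ is odd and $G_r=\overline{K_{a_r}}$ ($a_r$ isolated vertices) if $r$ is even; for $i=r-1,\ldots,1$, let $G_i$ be obtained from $G_{i+1}$ by adding $a_i$ new vertices adjacent to each other and to all vertices of $G_{i+1}$ if $i$ is odd, and by adding $a_i$ new isolated vertices if $i$ is even; then $T_G(a_1,\ldots,a_r)=G_1$. The functions $f,g$ are $f(X,Y)=\frac{XY-1}{X+Y-2}$ and $g(X,Y)=\frac{XY}{X+Y}$. *)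

theory Defs
  imports "Jordan_Normal_Form.Char_Poly"
begin

text \<open>
  A finite graph is given by its number \<open>n\<close> of vertices and its set of edges, the vertices being
  \<open>0, \<dots>, n - 1\<close>; it is simple iff every edge is a two-element set of vertices.
\<close>

type_synonym ngraph = "nat \<times> nat set set"

definition simple_ngraph :: "ngraph \<Rightarrow> bool" where
  "simple_ngraph G \<longleftrightarrow> (\<forall>e\<in>snd G. e \<subseteq> {..<fst G} \<and> card e = 2)"

definition adj_matrix :: "ngraph \<Rightarrow> real mat" where
  "adj_matrix G = mat (fst G) (fst G) (\<lambda>(u, v). if {u, v} \<in> snd G then 1 else 0)"

definition eigenvalue_free :: "real set \<Rightarrow> ngraph \<Rightarrow> bool" where
  "eigenvalue_free I G \<longleftrightarrow> (\<forall>x\<in>I. \<not> eigenvalue (adj_matrix G) x)"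

definition complete_ngraph :: "nat \<Rightarrow> ngraph" where
  "complete_ngraph k = (k, {{u, v} | u v. u < k \<and> v < k \<and> u \<noteq> v})"

definition empty_ngraph :: "nat \<Rightarrow> ngraph" where
  "empty_ngraph k = (k, {})"

text \<open>In the next two definitions the new vertices are \<open>n, \<dots>, n + k - 1\<close>, where \<open>n = fst G\<close>.\<close>

definition add_isolated :: "nat \<Rightarrow> ngraph \<Rightarrow> ngraph" where
  "add_isolated k G = (fst G + k, snd G)"

definition add_dominating :: "nat \<Rightarrow> ngraph \<Rightarrow> ngraph" where
  "add_dominating k G =
    (fst G + k, snd G \<union> {{u, v} | u v. u \<in> {fst G..<fst G + k} \<and> v \<in> {..<fst G + k} \<and> u \<noteq> v})"

text \<open>
  \<open>threshold_from a r i\<close> is the graph \<open>G\<^sub>i\<close> in the construction of \<open>T\<^sub>G(a\<^sub>1, \<dots>, a\<^sub>r)\<close>, for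
  \<open>1 \<le> i \<le> r\<close>. Only the values of \<open>a\<close> on \<open>{1..r}\<close> matter.
\<close>

function threshold_from :: "(nat \<Rightarrow> nat) \<Rightarrow> nat \<Rightarrow> nat \<Rightarrow> ngraph" where
  "threshold_from a r i =
    (if i \<ge> r then (if odd r then complete_ngraph (a r) else empty_ngraph (a r))
     else if odd i then add_dominating (a i) (threshold_from a r (Suc i))
     else add_isolated (a i) (threshold_from a r (Suc i)))"
  by pat_completeness auto
termination by (relation "measure (\<lambda>(a, r, i). r - i)") auto

declare threshold_from.simps [simp del]

definition threshold_graph :: "(nat \<Rightarrow> nat) \<Rightarrow> nat \<Rightarrow> ngraph" where
  "threshold_graph a r = threshold_from a r 1"

definition thr_f :: "real \<Rightarrow> real \<Rightarrow> real" where
  "thr_f X Y = (X * Y - 1) / (X + Y - 2)"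

definition thr_g :: "real \<Rightarrow> real \<Rightarrow> real" where
  "thr_g X Y = (X * Y) / (X + Y)"

lemma simple_add_isolated: "simple_ngraph G \<Longrightarrow> simple_ngraph (add_isolated k G)"
  by (fastforce simp: simple_ngraph_def add_isolated_def)

lemma simple_add_dominating: "simple_ngraph G \<Longrightarrow> simple_ngraph (add_dominating k G)"
  by (fastforce simp: simple_ngraph_def add_dominating_def card_2_iff)

lemma simple_threshold_from: "simple_ngraph (threshold_from a r i)"
proof (induction a r i rule: threshold_from.induct)
  case (1 a r i)
  have "simple_ngraph (complete_ngraph k)" "simple_ngraph (empty_ngraph k)" for k
    by (auto simp: simple_ngraph_def complete_ngraph_def empty_ngraph_def)
  with 1 show ?case
    by (subst threshold_from.simps) (auto intro: simple_add_isolated simple_add_dominating)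
qed

lemma simple_threshold_graph: "simple_ngraph (threshold_graph a r)"
  by (simp add: threshold_graph_def simple_threshold_from)

end

theory Submission
  imports Defs
begin

text \<open>
  Fix \<open>x \<in> [M, -1)\<close> and perturb the eigenvalue equation of \<open>G\<^sub>i\<close> by a constant \<open>d\<close>, which stands
  for the contribution of the dominating vertices added after \<open>G\<^sub>i\<close>: \<open>x v = d 1 + A v\<close>.
  Every solution satisfies \<open>d = - \<sigma>\<^sub>i S\<close>, where \<open>S\<close> is the sum of the entries of \<open>v\<close> and \<open>\<sigma>\<^sub>i\<close>
  obeys the recursion of \<open>s\<^sub>i\<close> with \<open>x\<close> in place of \<open>M\<close>. As \<open>f\<close> and \<open>g\<close> are increasing in both
  arguments on the relevant ranges, \<open>\<sigma>\<^sub>i \<le> s\<^sub>i\<close>, so the lower bounds on \<open>a\<^sub>i\<close> keep \<open>\<sigma>\<^sub>i > 1\<close> for odd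
  \<open>i\<close> and \<open>0 < \<sigma>\<^sub>i < 1\<close> for even \<open>i\<close>. An eigenvector is a solution with \<open>d = 0\<close>; since
  \<open>\<sigma>\<^sub>i \<noteq> 0\<close>, this forces \<open>S = 0\<close>, and then \<open>v = 0\<close> layer by layer.
\<close>

section \<open>The perturbed eigenvalue equation\<close>

definition neighbour_sum :: "ngraph \<Rightarrow> (nat \<Rightarrow> real) \<Rightarrow> nat \<Rightarrow> real" where
  "neighbour_sum G v u = (\<Sum>w<fst G. if {u, w} \<in> snd G then v w else 0)"

text \<open>The formula for \<open>d\<close> alone would not exclude eigenvectors whose entries sum
  to zero, hence the second conjunct. As \<open>v\<close> is a function on all of
  \<open>nat\<close>, a solution on an enlarged graph can be fed unchanged to the smaller
  one.\<close>

definition shift_ratio :: "real \<Rightarrow> real \<Rightarrow> ngraph \<Rightarrow> bool" where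
  "shift_ratio x \<sigma> G \<longleftrightarrow>
    (\<forall>v d. (\<forall>u<fst G. x * v u = d + neighbour_sum G v u) \<longrightarrow>
      d = - \<sigma> * (\<Sum>u<fst G. v u) \<and> (d = 0 \<longrightarrow> (\<forall>u<fst G. v u = 0)))"

lemma shift_ratioI:
  assumes "\<And>v d. (\<And>u. u < fst G \<Longrightarrow> x * v u = d + neighbour_sum G v u) \<Longrightarrow>
      d = - \<sigma> * (\<Sum>u<fst G. v u)"
    and "\<And>v d. (\<And>u. u < fst G \<Longrightarrow> x * v u = d + neighbour_sum G v u) \<Longrightarrow>
      d = 0 \<Longrightarrow> \<forall>u<fst G. v u = 0"
  shows "shift_ratio x \<sigma> G"
  using assms unfolding shift_ratio_def by blast

lemma shift_ratioD:
  assumes "shift_ratio x \<sigma> G" "\<And>u. u < fst G \<Longrightarrow> x * v u = d + neighbour_sum G v u"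
  shows "d = - \<sigma> * (\<Sum>u<fst G. v u)" and "d = 0 \<Longrightarrow> \<forall>u<fst G. v u = 0"
  using assms unfolding shift_ratio_def by blast+

lemma shift_ratio_not_eigenvalue:
  assumes "shift_ratio x \<sigma> G"
  shows "\<not> eigenvalue (adj_matrix G) x"
proof
  let ?n = "fst G"
  assume "eigenvalue (adj_matrix G) x"
  then obtain v where v: "v \<in> carrier_vec ?n" "v \<noteq> 0\<^sub>v ?n" "adj_matrix G *\<^sub>v v = x \<cdot>\<^sub>v v"
    unfolding eigenvalue_def eigenvector_def by (auto simp: adj_matrix_def)
  have "x * v $ u = 0 + neighbour_sum G (\<lambda>u. v $ u) u" if u: "u < ?n" for u
  proof -
    have "x * v $ u = (adj_matrix G *\<^sub>v v) $ u"
      using u v by simp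
    also have "\<dots> = (\<Sum>w<?n. (if {u, w} \<in> snd G then 1 else 0) * v $ w)"
      using u v(1) by (simp add: adj_matrix_def scalar_prod_def lessThan_atLeast0)
    also have "\<dots> = neighbour_sum G (\<lambda>u. v $ u) u"
      unfolding neighbour_sum_def by (intro sum.cong) auto
    finally show ?thesis by simp
  qed
  from shift_ratioD(2)[OF assms this] have "\<forall>u<?n. v $ u = 0" by simp
  with v(1) have "v = 0\<^sub>v ?n" by (intro eq_vecI) auto
  with v(2) show False by contradiction
qed

section \<open>Neighbour sums under the graph constructions\<close>

lemma sum_lessThan_add_split:
  "(\<Sum>u<n + k. h u) = (\<Sum>u<n. h u) + (\<Sum>u=n..<n + k. h u)"
  for h :: "nat \<Rightarrow> real"
  by (metis le_add1 lessThan_atLeast0 sum.atLeastLessThan_concat zero_le)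

lemma simple_ngraph_edgeD:
  assumes "simple_ngraph G" "{u, w} \<in> snd G"
  shows "u < fst G" "w < fst G"
  using assms unfolding simple_ngraph_def by blast+

lemma sum_lessThan_except:
  fixes v :: "nat \<Rightarrow> real"
  assumes "u < n"
  shows "(\<Sum>w<n. if w \<noteq> u then v w else 0) = (\<Sum>w<n. v w) - v u"
proof -
  have "(\<Sum>w<n. if w \<noteq> u then v w else 0) = (\<Sum>w<n. v w - (if w = u then v w else 0))"
    by (intro sum.cong) auto
  then show ?thesis
    using assms by (simp add: sum_subtractf sum.delta')
qed

lemma neighbour_sum_complete:
  assumes "u < k"
  shows "neighbour_sum (complete_ngraph k) v u = (\<Sum>w<k. v w) - v u"
proof -
  have "{u, w} \<in> snd (complete_ngraph k) \<longleftrightarrow> w \<noteq> u" if "w < k" for w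
    using assms that by (auto simp: complete_ngraph_def doubleton_eq_iff)
  then have "neighbour_sum (complete_ngraph k) v u = (\<Sum>w<k. if w \<noteq> u then v w else 0)"
    unfolding neighbour_sum_def by (intro sum.cong) (auto simp: complete_ngraph_def)
  with sum_lessThan_except[OF assms] show ?thesis by simp
qed

lemma neighbour_sum_add_isolated:
  assumes "simple_ngraph G"
  shows "neighbour_sum (add_isolated k G) v u = neighbour_sum G v u"
proof -
  have "(\<Sum>w=fst G..<fst G + k. if {u, w} \<in> snd G then v w else 0) = 0"
    using simple_ngraph_edgeD[OF assms] by (intro sum.neutral) force
  then show ?thesis
    by (simp add: neighbour_sum_def add_isolated_def sum_lessThan_add_split)
qed

lemma neighbour_sum_outside:
  assumes "simple_ngraph G" "fst G \<le> u"
  shows "neighbour_sum G v u = 0"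
  unfolding neighbour_sum_def
  using simple_ngraph_edgeD[OF assms(1)] assms(2) by (intro sum.neutral) force

lemma edge_add_dominating_iff:
  assumes "simple_ngraph G" "u < fst G + k" "w < fst G + k"
  shows "{u, w} \<in> snd (add_dominating k G) \<longleftrightarrow>
    (if u < fst G \<and> w < fst G then {u, w} \<in> snd G else u \<noteq> w)"
proof (cases "u < fst G \<and> w < fst G")
  case True
  then show ?thesis
    by (auto simp: add_dominating_def doubleton_eq_iff)
next
  case False
  then have "{u, w} \<in> snd (add_dominating k G) \<longleftrightarrow>
      (\<exists>p q. {u, w} = {p, q} \<and> fst G \<le> p \<and> p < fst G + k \<and> q < fst G + k \<and> p \<noteq> q)"
    using simple_ngraph_edgeD[OF assms(1), of u w] by (auto simp: add_dominating_def)
  also have "\<dots> \<longleftrightarrow> u \<noteq> w"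
  proof
    show "u \<noteq> w" if "\<exists>p q. {u, w} = {p, q} \<and> fst G \<le> p \<and> p < fst G + k \<and> q < fst G + k \<and> p \<noteq> q"
      using that by (auto simp: doubleton_eq_iff)
    assume "u \<noteq> w"
    then show "\<exists>p q. {u, w} = {p, q} \<and> fst G \<le> p \<and> p < fst G + k \<and> q < fst G + k \<and> p \<noteq> q"
      \<comment> \<open>The witness \<open>p\<close> must be a new vertex: \<open>u\<close> if it is
        new, otherwise \<open>w\<close>, with the pair swapped.\<close>
      using False assms(2,3)
      by (cases "fst G \<le> u") (blast, metis insert_commute not_le)
  qed
  finally show ?thesis
    by (simp only: False if_False)
qed

lemma neighbour_sum_add_dominating_old:
  assumes "simple_ngraph G" "u < fst G"
  shows "neighbour_sum (add_dominating k G) v u =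
    neighbour_sum G v u + (\<Sum>w=fst G..<fst G + k. v w)"
proof -
  have "fst (add_dominating k G) = fst G + k"
    by (simp add: add_dominating_def)
  then show ?thesis
    using assms unfolding neighbour_sum_def
    by (auto simp: sum_lessThan_add_split edge_add_dominating_iff intro!: sum.cong arg_cong2[where f = "(+)"])
qed

lemma neighbour_sum_add_dominating_new:
  assumes "simple_ngraph G" "fst G \<le> u" "u < fst G + k"
  shows "neighbour_sum (add_dominating k G) v u = (\<Sum>w<fst G + k. v w) - v u"
proof -
  have "neighbour_sum (add_dominating k G) v u = (\<Sum>w<fst G + k. if w \<noteq> u then v w else 0)"
    unfolding neighbour_sum_def
  proof (rule sum.cong)
    show "{..<fst (add_dominating k G)} = {..<fst G + k}"
      by (simp add: add_dominating_def)
    show "(if {u, w} \<in> snd (add_dominating k G) then v w else 0) = (if w \<noteq> u then v w else 0)"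
      if "w \<in> {..<fst G + k}" for w
      using that assms by (subst edge_add_dominating_iff) auto
  qed
  with sum_lessThan_except[OF assms(3)] show ?thesis by simp
qed

section \<open>The ratio under the graph constructions\<close>

lemma eq_neg_divide_multI:
  fixes d p q S :: real
  assumes "d * q = - p * S" "q \<noteq> 0"
  shows "d = - (p / q) * S"
  using assms by (simp add: field_simps)

text \<open>At every vertex the equation reads \<open>x * v u = d + S - v u\<close>, so
  \<open>v\<close> has a constant value \<open>c\<close> with \<open>(x + 1) * c = d + S\<close>.
  With \<open>S = k * c\<close> this gives \<open>d = (x + 1 - k) * c\<close>, whose factor is
  negative.\<close>

lemma shift_ratio_complete:
  assumes "x < -1" "0 < k"
  shows "shift_ratio x (1 - (x + 1) / real k) (complete_ngraph k)"
proof (rule shift_ratioI)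
  fix v d
  assume eq: "\<And>u. u < fst (complete_ngraph k) \<Longrightarrow>
    x * v u = d + neighbour_sum (complete_ngraph k) v u"
  have n: "fst (complete_ngraph k) = k"
    by (simp add: complete_ngraph_def)
  define S where "S = (\<Sum>u<k. v u)"
  define c where "c = (d + S) / (x + 1)"
  have v: "v u = c" if "u < k" for u
    using eq[of u] that assms(1)
    by (simp add: n neighbour_sum_complete S_def c_def field_simps)
  have S: "S = real k * c"
    unfolding S_def using v by simp
  have c: "(x + 1) * c = d + S"
    using assms(1) by (simp add: c_def)
  show "d = - (1 - (x + 1) / real k) * (\<Sum>u<fst (complete_ngraph k). v u)"
  proof -
    have "d = (x + 1) * c - real k * c"
      using c S by simp
    moreover have "- (1 - (x + 1) / real k) * (real k * c) = (x + 1) * c - real k * c"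
      using assms(2) by (simp add: left_diff_distrib)
    ultimately show ?thesis
      unfolding n S_def[symmetric] S by (rule trans[OF _ sym])
  qed
  assume "d = 0"
  then have "(x + 1 - real k) * c = 0"
    using c S by (simp add: algebra_simps)
  then have "c = 0"
    using assms(1) by auto
  then show "\<forall>u<fst (complete_ngraph k). v u = 0"
    using v n by simp
qed

text \<open>A new vertex sees no neighbours, so it carries \<open>d / x\<close>, while
  \<open>G\<close> keeps the shift \<open>d\<close>. Hence
  \<open>d = - \<sigma> * (S - k * d / x)\<close>, and solving for \<open>d\<close> produces
  \<open>thr_g\<close>; the signs of \<open>x\<close> and \<sigma> keep its denominator
  positive.\<close>

lemma shift_ratio_add_isolated:
  assumes G: "simple_ngraph G" "shift_ratio x \<sigma> G" and "x < 0" "0 < k" "0 < \<sigma>"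
  shows "shift_ratio x (thr_g \<sigma> (- x / real k)) (add_isolated k G)"
proof (rule shift_ratioI)
  let ?H = "add_isolated k G"
  have n: "fst ?H = fst G + k"
    by (simp add: add_isolated_def)
  fix v d
  assume eq: "\<And>u. u < fst ?H \<Longrightarrow> x * v u = d + neighbour_sum ?H v u"
  then have old: "\<And>u. u < fst G \<Longrightarrow> x * v u = d + neighbour_sum G v u"
    by (simp add: n neighbour_sum_add_isolated[OF G(1)])
  have new: "v u = d / x" if "fst G \<le> u" "u < fst G + k" for u
    using eq[of u] that \<open>x < 0\<close>
    by (simp add: n neighbour_sum_add_isolated[OF G(1)] neighbour_sum_outside[OF G(1)] field_simps)
  define S where "S = (\<Sum>u<fst ?H. v u)"
  have S: "S = (\<Sum>u<fst G. v u) + real k * (d / x)"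
    unfolding S_def n sum_lessThan_add_split using new by simp
  note IH = shift_ratioD[OF G(2) old]
  have "d = - \<sigma> * (S - real k * (d / x))"
    using IH(1) S by simp
  then have "d * (\<sigma> + - x / real k) = - (\<sigma> * (- x / real k)) * S"
    using \<open>x < 0\<close> \<open>0 < k\<close> by (simp add: field_simps)
  moreover have "\<sigma> + - x / real k > 0"
    using \<open>x < 0\<close> \<open>0 < k\<close> \<open>0 < \<sigma>\<close> by (intro add_pos_pos divide_pos_pos) auto
  ultimately show "d = - thr_g \<sigma> (- x / real k) * (\<Sum>u<fst ?H. v u)"
    unfolding S_def[symmetric] thr_g_def by (intro eq_neg_divide_multI) auto
  assume "d = 0"
  then show "\<forall>u<fst ?H. v u = 0"
    using IH(2) new n by (metis div_0 not_le)
qed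

text \<open>All new vertices carry one value \<open>c\<close>, and \<open>G\<close> sees the shift
  \<open>d + k * c\<close>. Eliminating \<open>c\<close> from
  \<open>d + k * c = - \<sigma> * (S - k * c)\<close> and \<open>(x + 1) * c = d + S\<close>
  produces \<open>thr_f\<close>.\<close>

lemma shift_ratio_add_dominating:
  assumes G: "simple_ngraph G" "shift_ratio x \<sigma> G" and "x < -1" "0 < k"
    and \<sigma>: "\<sigma> + (1 - (x + 1) / real k) < 2" "thr_f \<sigma> (1 - (x + 1) / real k) \<noteq> 0"
  shows "shift_ratio x (thr_f \<sigma> (1 - (x + 1) / real k)) (add_dominating k G)"
proof -
  let ?H = "add_dominating k G" and ?Y = "1 - (x + 1) / real k"
  have n: "fst ?H = fst G + k"
    by (simp add: add_dominating_def)
  \<comment> \<open>Both conclusions are proved together, since the vanishing of \<open>v\<close>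
    relies on the formula for \<open>d\<close>.\<close>
  have *: "d = - thr_f \<sigma> ?Y * (\<Sum>u<fst ?H. v u) \<and> (d = 0 \<longrightarrow> (\<forall>u<fst ?H. v u = 0))"
    if eq: "\<And>u. u < fst ?H \<Longrightarrow> x * v u = d + neighbour_sum ?H v u" for v d
  proof -
    define S where "S = (\<Sum>u<fst ?H. v u)"
    define c where "c = (d + S) / (x + 1)"
    have new: "v u = c" if "fst G \<le> u" "u < fst G + k" for u
      using eq[of u] that \<open>x < -1\<close>
      by (simp add: n neighbour_sum_add_dominating_new[OF G(1)] S_def c_def field_simps)
    have new_sum: "(\<Sum>u=fst G..<fst G + k. v u) = real k * c"
      using new by simp
    have S: "S = (\<Sum>u<fst G. v u) + real k * c"
      unfolding S_def n sum_lessThan_add_split new_sum ..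
    have old: "x * v u = (d + real k * c) + neighbour_sum G v u" if "u < fst G" for u
      using eq[of u] that by (simp add: n neighbour_sum_add_dominating_old[OF G(1)] new_sum)
    note IH = shift_ratioD[OF G(2) old]
    have kc: "real k * c * (1 - ?Y) = d + S"
      using \<open>x < -1\<close> \<open>0 < k\<close> by (simp add: c_def)
    have "(d + real k * c) * (1 - ?Y) = - \<sigma> * (S - real k * c) * (1 - ?Y)"
      using IH(1) S by simp
    \<comment> \<open>Abstracting \<open>k * c\<close> to \<open>t\<close> and \<open>?Y\<close> to
      \<open>Y\<close> turns the elimination into polynomial algebra: every
      \<open>t * (1 - Y)\<close> is replaced by \<open>d + S\<close>.\<close>
    moreover have "d * (\<sigma> + Y - 2) = - (\<sigma> * Y - 1) * S"
      if "(d + t) * (1 - Y) = - \<sigma> * (S - t) * (1 - Y)" "t * (1 - Y) = d + S" for t Y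
    proof -
      have "d * (1 - Y) + t * (1 - Y) = - \<sigma> * (S * (1 - Y) - t * (1 - Y))"
        using that(1) by (simp add: algebra_simps)
      then show ?thesis
        unfolding that(2) by (simp add: algebra_simps)
    qed
    ultimately have "d * (\<sigma> + ?Y - 2) = - (\<sigma> * ?Y - 1) * S"
      using kc by blast
    then have d: "d = - thr_f \<sigma> ?Y * S"
      using \<sigma>(1) unfolding thr_f_def by (intro eq_neg_divide_multI) auto
    have "\<forall>u<fst ?H. v u = 0" if "d = 0"
    proof -
      \<comment> \<open>A nonzero ratio turns \<open>d = 0\<close> into \<open>S = 0\<close>, hence
        \<open>c = 0\<close>. The shift \<open>d + k * c\<close> seen by \<open>G\<close> then
        vanishes as well.\<close>
      have "c = 0"
        using d \<sigma>(2) that by (simp add: c_def)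
      then show ?thesis
        using IH(2) new n that by (metis add_0 mult_zero_right not_le)
    qed
    with d show ?thesis
      unfolding S_def by blast
  qed
  then show ?thesis
    by (intro shift_ratioI) blast+
qed

section \<open>Monotonicity and bounds for \<open>thr_g\<close> and \<open>thr_f\<close>\<close>

lemma thr_g_mono:
  assumes "0 < X" "X \<le> X'" "0 < Y" "Y \<le> Y'"
  shows "thr_g X Y \<le> thr_g X' Y'"
proof -
  \<comment> \<open>These two inequalities add up to the cross-multiplied claim.\<close>
  have "X * Y * X' \<le> X * Y' * X'" "X * Y * Y' \<le> X' * Y * Y'"
    using assms by (auto intro!: mult_mono)
  then have "X * Y * (X' + Y') \<le> X' * Y' * (X + Y)"
    by (simp add: algebra_simps)
  then show ?thesis
    using assms by (simp add: thr_g_def frac_le_eq field_simps)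
qed

text \<open>The partial derivative in \<open>X\<close> is
  \<open>(Y - 1)\<^sup>2 / (X + Y - 2)\<^sup>2\<close>, and symmetrically in \<open>Y\<close>. The
  bound on \<open>X' + Y'\<close> keeps both points on the same side of the pole
  \<open>X + Y = 2\<close>.\<close>

lemma thr_f_mono:
  assumes "X \<le> X'" "Y \<le> Y'" "X' + Y' < 2"
  shows "thr_f X Y \<le> thr_f X' Y'"
proof -
  have left: "thr_f A C \<le> thr_f B C" if "A \<le> B" "B + C < 2" for A B C
  proof -
    \<comment> \<open>This is the difference of the two sides of the next inequality.\<close>
    have "0 \<le> (B - A) * (C - 1)\<^sup>2"
      using that by simp
    then have "(1 - A * C) * (2 - B - C) \<le> (1 - B * C) * (2 - A - C)"
      by (simp add: algebra_simps power2_eq_square)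
    moreover have "thr_f A C = (1 - A * C) / (2 - A - C)" for A C
      unfolding thr_f_def by (metis minus_diff_eq minus_divide_divide diff_diff_eq)
    ultimately show ?thesis
      using that by (simp add: divide_le_eq pos_le_divide_eq)
  qed
  have commute: "thr_f A B = thr_f B A" for A B
    by (simp add: thr_f_def algebra_simps)
  have "thr_f X Y \<le> thr_f X' Y"
    using assms by (intro left) auto
  also have "\<dots> \<le> thr_f X' Y'"
    using left[of Y Y' X'] assms by (simp add: commute)
  finally show ?thesis .
qed

text \<open>The last hypothesis is \<open>X * Y < X + Y\<close> rearranged to match the lower bound
  on \<open>a i\<close> for even \<open>i\<close>.\<close>

lemma thr_g_less_one:
  assumes "0 < X" "0 < Y" "Y * (X - 1) < X"
  shows "thr_g X Y < 1"
  using assms by (simp add: thr_g_def divide_less_eq algebra_simps)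

text \<open>Here \<open>thr_f X Y - 1 = (X - 1) * (Y - 1) / (X + Y - 2)\<close>, a quotient of two
  negative numbers.\<close>

lemma thr_f_gt_one:
  assumes "X < 1" "1 < Y" "X + Y < 2"
  shows "1 < thr_f X Y"
proof -
  have "0 < (1 - X) * (Y - 1)"
    using assms by simp
  then show ?thesis
    using assms by (simp add: thr_f_def less_divide_eq algebra_simps)
qed

text \<open>Downward induction from \<open>r\<close>. For even \<open>i\<close> the upper bound 1 is
  imposed on \<open>s i\<close> rather than on \<sigma>, because the choice of the next
  \<open>a\<close> is governed by \<open>s\<close>; it passes to \<sigma> through
  \<open>\<sigma> \<le> s i\<close>.\<close>

lemma threshold_from_shift_ratio:
  fixes M x :: real
  assumes x: "M \<le> x" "x < -1" and r: "odd r" and pos: "\<forall>i\<in>{1..r}. 0 < a i"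
    and sr: "s r = 1 - (M + 1) / real (a r)"
    and ev: "\<forall>i\<in>{1..<r}. even i \<longrightarrow>
           real (a i) > - M * (1 - 1 / s (i + 1)) \<and>
           s i = thr_g (s (i + 1)) (- M / real (a i))"
    and od: "\<forall>i\<in>{1..<r}. odd i \<longrightarrow>
           real (a i) > - (M + 1) / (1 - s (i + 1)) \<and>
           s i = thr_f (s (i + 1)) (1 - (M + 1) / real (a i))"
    and i: "1 \<le> i" "i \<le> r"
  shows "\<exists>\<sigma>. shift_ratio x \<sigma> (threshold_from a r i) \<and> \<sigma> \<le> s i \<and>
    (if odd i then 1 < \<sigma> else 0 < \<sigma> \<and> s i < 1)"
  using i(2,1)
proof (induction i rule: inc_induct)
  case base
  have a: "0 < a r"
    using pos base by simp
  then have "(M + 1) / real (a r) \<le> (x + 1) / real (a r)" "(x + 1) / real (a r) < 0"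
    using x by (auto simp: divide_right_mono divide_neg_pos)
  then show ?case
    using shift_ratio_complete[OF x(2) a] r sr
    by (intro exI[of _ "1 - (x + 1) / real (a r)"]) (auto simp: threshold_from.simps[of a r r])
next
  case (step i)
  then obtain \<sigma> where \<sigma>: "shift_ratio x \<sigma> (threshold_from a r (Suc i))" "\<sigma> \<le> s (Suc i)"
    "if odd (Suc i) then 1 < \<sigma> else 0 < \<sigma> \<and> s (Suc i) < 1"
    by auto
  have a: "0 < a i" and ir: "i \<in> {1..<r}"
    using pos step by auto
  note simple = simple_threshold_from[of a r "Suc i"]
  show ?case
  proof (cases "odd i")
    case True
    let ?Y = "1 - (x + 1) / real (a i)" and ?Y' = "1 - (M + 1) / real (a i)"
    have s: "0 < \<sigma>" "s (Suc i) < 1"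
      using \<sigma>(3) True by auto
    have "- (M + 1) / (1 - s (Suc i)) < real (a i)" and si: "s i = thr_f (s (Suc i)) ?Y'"
      using od ir True by auto
    \<comment> \<open>The lower bound on \<open>a i\<close> says exactly that the denominator of
      \<open>thr_f\<close> is negative at \<open>M\<close>. Since \<open>\<sigma> + ?Y\<close> is no
      larger, it is negative at \<open>x\<close> too.\<close>
    then have Y': "s (Suc i) + ?Y' < 2"
      using s a by (simp add: field_simps)
    have Y: "1 < ?Y" "?Y \<le> ?Y'"
      using x a by (auto simp: divide_neg_pos divide_right_mono)
    have gt: "1 < thr_f \<sigma> ?Y"
      using s Y Y' \<sigma>(2) by (intro thr_f_gt_one) auto
    have "threshold_from a r i = add_dominating (a i) (threshold_from a r (Suc i))"
      using True ir by (subst threshold_from.simps) auto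
    moreover have "shift_ratio x (thr_f \<sigma> ?Y) (add_dominating (a i) (threshold_from a r (Suc i)))"
      using gt Y Y' \<sigma>(2) by (intro shift_ratio_add_dominating simple \<sigma>(1) x(2) a) auto
    moreover have "thr_f \<sigma> ?Y \<le> s i"
      unfolding si using \<sigma>(2) Y(2) Y' by (rule thr_f_mono)
    ultimately show ?thesis
      using True gt by (intro exI[of _ "thr_f \<sigma> ?Y"]) simp
  next
    case False
    let ?Y = "- x / real (a i)" and ?Y' = "- M / real (a i)"
    have s: "1 < \<sigma>"
      using \<sigma>(3) False by auto
    have bound: "- M * (1 - 1 / s (Suc i)) < real (a i)" and si: "s i = thr_g (s (Suc i)) ?Y'"
      using ev ir False by auto
    have Y: "0 < ?Y" "?Y \<le> ?Y'"
      using x a by (auto simp: divide_neg_pos divide_right_mono)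
    \<comment> \<open>The lower bound on \<open>a i\<close>, multiplied by the positive number
      \<open>s (Suc i) / a i\<close>.\<close>
    have "?Y' * (s (Suc i) - 1) < s (Suc i)"
      using bound s \<sigma>(2) a by (simp add: field_simps)
    then have lt: "s i < 1"
      unfolding si using s \<sigma>(2) Y by (intro thr_g_less_one) auto
    have "threshold_from a r i = add_isolated (a i) (threshold_from a r (Suc i))"
      using False ir by (subst threshold_from.simps) auto
    moreover have "shift_ratio x (thr_g \<sigma> ?Y) (add_isolated (a i) (threshold_from a r (Suc i)))"
      using s x by (intro shift_ratio_add_isolated simple \<sigma>(1) a) auto
    moreover have "thr_g \<sigma> ?Y \<le> s i"
      unfolding si using s \<sigma>(2) Y by (intro thr_g_mono) auto
    moreover have "0 < thr_g \<sigma> ?Y"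
      unfolding thr_g_def using s Y(1) by (intro divide_pos_pos[OF mult_pos_pos add_pos_pos]) linarith+
    ultimately show ?thesis
      using False lt by (intro exI[of _ "thr_g \<sigma> ?Y"]) simp
  qed
qed

theorem theorem6:
  fixes M :: real and r :: nat and a :: "nat \<Rightarrow> nat" and s :: "nat \<Rightarrow> real"
  assumes "M < -1"
    and "odd r"
    and "\<forall>i\<in>{1..r}. 0 < a i"
    and "2 \<le> a r"
    and "s r = 1 - (M + 1) / real (a r)"
    and "\<forall>i\<in>{1..<r}. even i \<longrightarrow>
           real (a i) > - M * (1 - 1 / s (i + 1)) \<and>
           s i = thr_g (s (i + 1)) (- M / real (a i))"
    and "\<forall>i\<in>{1..<r}. odd i \<longrightarrow>
           real (a i) > - (M + 1) / (1 - s (i + 1)) \<and>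
           s i = thr_f (s (i + 1)) (1 - (M + 1) / real (a i))"
  shows "eigenvalue_free {M..<-1} (threshold_graph a r)"
  unfolding eigenvalue_free_def threshold_graph_def
proof
  fix x
  assume "x \<in> {M..<-1}"
  moreover have "1 \<le> r"
    using \<open>odd r\<close> by (simp add: odd_pos Suc_leI)
  ultimately obtain \<sigma> where "shift_ratio x \<sigma> (threshold_from a r 1)"
    using threshold_from_shift_ratio[OF _ _ assms(2,3,5,6,7), of x 1] by auto
  then show "\<not> eigenvalue (adj_matrix (threshold_from a r 1)) x"
    by (rule shift_ratio_not_eigenvalue)
qed

end
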